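(* Let $k\in\mathbb{N}$ and let $a>0$ be real. Then the following two identities hold: $$\sum_{n=1}^\infty\frac{H_nH_n^{(2)}}{(n+a)(n+a+k)}=\frac1k\left\{\begin{aligned}&\sum_{i=0}^{k-1}\frac{1}{a+i}\sum_{n=1}^\infty\frac{H_{n+a+i}}{n^2}-\sum_{i=0}^{k-1}\frac{H_{a+i}^2+H_{a+i}^{(2)}}{2(a+i)^2}\\&-\zeta(2)H_k^{(2)}(a-1)+\sum_{i=0}^{k-1}\frac{H_{a+i}}{(a+i)^3}\end{aligned}\right\},$$ $$\sum_{n=1}^\infty\frac{H_n^3}{(n+a)(n+a+k)}=\frac1k\left\{\begin{aligned}&\sum_{i=1}^{k}\frac{H_{a+i-1}^3+3H_{a+i-1}H_{a+i-1}^{(2)}+2H_{a+i-1}^{(3)}}{a+i-1}\\&+3\sum_{i=0}^{k-1}\frac{1}{a+i}\sum_{n=1}^\infty\frac{H_{n+a+i}}{n^2}+3\sum_{i=1}^{k-1}\frac{H_{a+i}}{(a+i)^3}\\&-\frac32\sum_{i=0}^{k-1}\frac{H_{a+i}^2+H_{a+i}^{(2)}}{(a+i)^2}-\zeta(2)H_{k-1}^{(2)}(a)\\&-2\sum_{i=1}^{k-1}\frac{H_i^{(1)}(a)}{(i+a)^3}-2\zeta(3)H_{k-1}^{(1)}(a)\\&-2H_aH_{k-1}^{(3)}(a)-2\frac{\zeta(3)}{a}-\frac{\zeta(2)}{a^2}+\frac{H_a}{a^3}\end{aligned}\right\}.$$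
   Context: $\mathbb{N}=\{1,2,3,\ldots\}$. For $n\in\mathbb{N}$, $H_n=\sum_{j=1}^n \frac1j$ and $H_n^{(2)}=\sum_{j=1}^n \frac1{j^2}$. Shifted harmonic numbers: for $\alpha\in\mathbb{C}\setminus\{-1,-2,\ldots\}$, $H_\alpha=\psi(\alpha+1)+\gamma=\sum_{l=1}^\infty\left(\frac1l-\frac1{l+\alpha}\right)$ ($\psi$ the digamma function, $\gamma$ the Euler–Mascheroni constant) and, for integers $m\ge2$, $H_\alpha^{(m)}=\zeta(m)-\zeta(m,\alpha+1)$, where $\zeta(s,c)=\sum_{n=0}^\infty (n+c)^{-s}$ is the Hurwitz zeta function and $\zeta$ the Riemann zeta function. Parametric harmonic numbers: $H_n^{(s)}(c)=\sum_{j=1}^n (j+c)^{-s}$ for $n\ge 0$, $c\in\mathbb{C}\setminus\{-1,-2,\ldots\}$, so $H_0^{(s)}(c)=0$. Empty sums are $0$. *)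

theory Defs
  imports "HOL-Analysis.Analysis"
begin

text \<open>
  The definitions are polymorphic so as to cover real and complex arguments. The order \<open>m\<close> of the
  zeta values and harmonic numbers is a natural number, which makes \<open>x ^ m\<close> unambiguous in both
  cases. The ordinary harmonic numbers \<open>H\<^sub>n\<close> are the library's \<^const>\<open>harm\<close>.
\<close>

definition harm_order :: "nat \<Rightarrow> nat \<Rightarrow> 'a::real_normed_field" where
  "harm_order m n = (\<Sum>j=1..n. 1 / of_nat j ^ m)"

text \<open>
  The two zeta functions are given by their defining series, which converge for \<open>m \<ge> 2\<close>
  (and \<open>c \<notin> {0, -1, -2, \<dots>}\<close>); for \<open>m < 2\<close> the values are meaningless.
\<close>

definition hurwitz_zeta :: "nat \<Rightarrow> 'a::{real_normed_field,banach} \<Rightarrow> 'a" where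
  "hurwitz_zeta m c = (\<Sum>n. 1 / (of_nat n + c) ^ m)"

definition riemann_zeta :: "nat \<Rightarrow> 'a::{real_normed_field,banach}" where
  "riemann_zeta m = (\<Sum>n. 1 / of_nat (Suc n) ^ m)"

text \<open>
  Harmonic numbers with a non-integer index \<open>\<alpha> \<notin> {-1, -2, \<dots>}\<close>, of order 1
  and of order \<open>m \<ge> 2\<close>.
\<close>

definition shifted_harm :: "'a::{real_normed_field,banach} \<Rightarrow> 'a" where
  "shifted_harm \<alpha> = Digamma (\<alpha> + 1) + euler_mascheroni"

definition shifted_harm_order :: "nat \<Rightarrow> 'a::{real_normed_field,banach} \<Rightarrow> 'a" where
  "shifted_harm_order m \<alpha> = riemann_zeta m - hurwitz_zeta m (\<alpha> + 1)"

text \<open>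
  Parametric harmonic numbers; \<open>param_harm s n c\<close> is written \<open>H\<^sub>n\<^bsup>(s)\<^esup>(c)\<close> on paper.
\<close>

definition param_harm :: "nat \<Rightarrow> nat \<Rightarrow> 'a::real_normed_field \<Rightarrow> 'a" where
  "param_harm s n c = (\<Sum>j=1..n. 1 / (of_nat j + c) ^ s)"

end

theory Submission
  imports Defs "HOL-Real_Asymp.Real_Asymp"
begin

text \<open>
  Telescoping in \<open>i\<close> splits \<open>k / ((n + a) (n + a + k))\<close> into the terms
  \<open>1 / ((n + b) (n + b + 1))\<close> with \<open>b = a + i\<close> and \<open>0 \<le> i < k\<close>. So both identities are sums over \<open>i\<close>
  of their case \<open>k = 1\<close> (lemmas \<open>harm_harm_order_2_sums\<close> and \<open>harm_cubed_sums\<close>), up to a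
  rearrangement of elementary terms in the second one. In the case \<open>k = 1\<close> the weight is a
  difference of two consecutive values of \<open>1 / (n + b)\<close>, and summation by parts applies.

  The core is a duality between elementary and complete homogeneous symmetric functions. Let
  \<open>e\<^sub>m(n)\<close> be the \<open>m\<close>-th elementary symmetric polynomial in \<open>1, 1/2, \<dots>, 1/n\<close>. Then
  \<open>G\<^sub>m(b) = (\<Sum>n\<ge>0. e\<^sub>m(n) (1 / (n + 1) - 1 / (n + 1 + b)))\<close> equals \<open>h\<^sub>m\<^sub>+\<^sub>1(b)\<close> for \<open>m \<le> 2\<close>, where \<open>h\<^sub>1(b) = H\<^sub>b\<close>, and
  \<open>h\<^sub>2(b)\<close> and \<open>h\<^sub>3(b)\<close> are the expressions in the harmonic numbers of index \<open>b\<close> which, for natural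
  \<open>b\<close>, are the complete homogeneous symmetric polynomials in \<open>1, 1/2, \<dots>, 1/b\<close>. By summation by
  parts, \<open>G\<^sub>m\<^sub>+\<^sub>1(b + 1) - G\<^sub>m\<^sub>+\<^sub>1(b) = G\<^sub>m(b + 1) / (b + 1)\<close>, and the functions \<open>h\<close> satisfy the same
  difference equation. Both sides are increasing and vanish at 0, and their increments tend to 0
  along the natural numbers; this leaves only one solution for real \<open>b \<ge> 0\<close>
  (\<open>mono_solutions_difference_equation_unique\<close>).

  For the product \<open>H\<^sub>n H\<^sub>n\<^sup>(\<^sup>2\<^sup>)\<close>, two summations by parts leave the series \<open>\<Sum> H\<^sub>n\<^sub>+\<^sub>b / n\<^sup>2\<close>, the value
  \<open>h\<^sub>2(b)\<close> and elementary terms. The cube then follows from Newton's identity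
  \<open>H\<^sub>n\<^sup>3 = 3 H\<^sub>n H\<^sub>n\<^sup>(\<^sup>2\<^sup>) - 2 H\<^sub>n\<^sup>(\<^sup>3\<^sup>) + 6 e\<^sub>3(n)\<close>, since the series of \<open>e\<^sub>3(n)\<close> with the same weights sums to \<open>G\<^sub>2(b) / b = h\<^sub>3(b) / b\<close>.
\<close>

section \<open>Logarithmic growth and summation by parts\<close>

lemma harm_Suc_le_1_plus_ln: "harm (Suc n) \<le> 1 + ln (real (Suc n))"
  using euler_mascheroni_sequence_decreasing[of 1 "Suc n"] by (simp add: harm_expand)

lemma harm_power_over_index_tendsto_0:
  "(\<lambda>n. harm (Suc n) ^ p / real (Suc n)) \<longlonglongrightarrow> 0"
proof (rule tendsto_sandwich[of "\<lambda>_. 0"])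
  show "(\<lambda>n. (1 + ln (real (Suc n))) ^ p / real (Suc n)) \<longlonglongrightarrow> 0"
    by real_asymp
qed (auto intro!: always_eventually divide_right_mono power_mono harm_Suc_le_1_plus_ln
       harm_nonneg divide_nonneg_pos zero_le_power simp del: of_nat_Suc)

lemma summable_harm_power_over_square:
  "summable (\<lambda>n. harm (Suc n) ^ p / real (Suc n) ^ 2)"
proof (rule summable_comparison_test)
  show "summable (\<lambda>n. (1 + ln (real (Suc n))) ^ p / real (Suc n) ^ 2)"
  proof (rule summable_comparison_test_bigo)
    show "summable (\<lambda>n. norm (real n powr (-3/2)))"
      by (simp add: summable_real_powr_iff)
    show "(\<lambda>n. (1 + ln (real (Suc n))) ^ p / real (Suc n) ^ 2) \<in> O(\<lambda>n. real n powr (-3/2))"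
      by real_asymp
  qed
  show "\<exists>N. \<forall>n\<ge>N. norm (harm (Suc n) ^ p / real (Suc n) ^ 2)
          \<le> (1 + ln (real (Suc n))) ^ p / real (Suc n) ^ 2"
    by (auto intro!: divide_right_mono power_mono harm_Suc_le_1_plus_ln harm_nonneg
          simp: power_abs simp del: of_nat_Suc)
qed

text \<open>
  The two general terms differ by \<open>u n * w n - u (Suc n) * w (Suc n)\<close>, and these differences telescope
  to 0.
\<close>
lemma sums_summation_by_parts:
  fixes u w :: "nat \<Rightarrow> real"
  assumes "u 0 = 0" and "(\<lambda>n. u n * w n) \<longlonglongrightarrow> 0"
    and "(\<lambda>n. (u (Suc n) - u n) * w n) sums S"
  shows "(\<lambda>n. u (Suc n) * (w n - w (Suc n))) sums S"
proof -
  have "(\<lambda>n. u n * w n - u (Suc n) * w (Suc n)) sums (u 0 * w 0 - 0)"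
    by (rule telescope_sums'[OF assms(2)])
  from sums_add[OF assms(3) this] show ?thesis
    using assms(1) by (simp add: algebra_simps)
qed

text \<open>
  The weight \<open>1 / ((x + b) (x + b + 1))\<close> is the decrement of \<open>1 / (x + b)\<close>, so summation by parts
  removes one denominator at the price of differencing \<open>u\<close>. A power of the harmonic numbers as
  majorant of \<open>u\<close> makes the boundary term vanish.
\<close>
lemma sums_consecutive_denominators:
  fixes u :: "nat \<Rightarrow> real" and b :: real
  assumes "b \<ge> 0" and "u 0 = 0" and "\<And>n. 0 \<le> u n" and "\<And>n. u n \<le> harm n ^ p"
    and "(\<lambda>n. (u (Suc n) - u n) / (real (Suc n) + b)) sums S"
  shows "(\<lambda>n. u (Suc n) / ((real (Suc n) + b) * (real (Suc n) + b + 1))) sums S"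
proof -
  have lim: "(\<lambda>n. u n * (1 / (real (Suc n) + b))) \<longlonglongrightarrow> 0"
  proof (rule tendsto_sandwich)
    show "\<forall>\<^sub>F n in sequentially. u n * (1 / (real (Suc n) + b)) \<le> harm (Suc n) ^ p / real (Suc n)"
    proof (intro always_eventually allI)
      fix n
      have "u n \<le> harm (Suc n) ^ p"
        using assms(4)[of n] power_mono[OF harm_mono[of n "Suc n"] harm_nonneg, of p]
        by (meson le_SucI order.refl order.trans)
      moreover have "1 / (real (Suc n) + b) \<le> 1 / real (Suc n)"
        using assms(1) by (intro divide_left_mono) auto
      ultimately have "u n * (1 / (real (Suc n) + b)) \<le> harm (Suc n) ^ p * (1 / real (Suc n))"
        using assms(1,3) by (intro mult_mono) (auto intro: harm_nonneg zero_le_power)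
      thus "u n * (1 / (real (Suc n) + b)) \<le> harm (Suc n) ^ p / real (Suc n)" by simp
    qed
    show "\<forall>\<^sub>F n in sequentially. 0 \<le> u n * (1 / (real (Suc n) + b))"
      using assms(1,3) by (auto intro!: always_eventually)
  qed (auto intro: harm_power_over_index_tendsto_0 simp del: of_nat_Suc)
  have "(\<lambda>n. u (Suc n) * (1 / (real (Suc n) + b) - 1 / (real (Suc (Suc n)) + b))) sums S"
    by (rule sums_summation_by_parts[where w = "\<lambda>n. 1 / (real (Suc n) + b)"])
      (use assms(2,5) lim in auto)
  moreover have "u (Suc n) * (1 / (real (Suc n) + b) - 1 / (real (Suc (Suc n)) + b))
      = u (Suc n) / ((real (Suc n) + b) * (real (Suc n) + b + 1))" for n
  proof -
    have "real (Suc n) + b > 0" "real (Suc n) + b + 1 > 0" using assms(1) by auto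
    thus ?thesis by (simp add: divide_simps)
  qed
  ultimately show ?thesis by simp
qed

section \<open>Harmonic numbers with real index\<close>

lemma shifted_harm_sums:
  fixes b :: real
  assumes "b > -1"
  shows "(\<lambda>n. 1 / real (Suc n) - 1 / (real (Suc n) + b)) sums shifted_harm b"
proof -
  have "summable (\<lambda>n. inverse (real (Suc n)) - inverse (b + 1 + real n))"
    using assms by (intro summable_Digamma) auto
  hence "(\<lambda>n. inverse (real (Suc n)) - inverse (b + 1 + real n)) sums shifted_harm b"
    unfolding shifted_harm_def Digamma_def by (simp add: summable_sums)
  thus ?thesis by (simp add: inverse_eq_divide add_ac)
qed

lemma shifted_harm_of_nat: "shifted_harm (real n) = harm n"
  using Digamma_of_nat[of n, where ?'a = real] by (simp add: shifted_harm_def add_ac)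

lemma shifted_harm_0: "shifted_harm (0::real) = 0"
  using shifted_harm_of_nat[of 0] by (simp add: harm_expand)

lemma shifted_harm_plus1:
  fixes b :: real
  assumes "b > -1"
  shows "shifted_harm (b + 1) = shifted_harm b + 1 / (b + 1)"
  using assms Digamma_plus1[of "b + 1"] by (simp add: shifted_harm_def)

lemma shifted_harm_add_of_nat:
  fixes b :: real
  assumes "b > -1"
  shows "shifted_harm (real n + b) = shifted_harm b + (\<Sum>j<n. 1 / (real (Suc j) + b))"
proof (induction n)
  case (Suc n)
  have "shifted_harm (real (Suc n) + b) = shifted_harm (real n + b + 1)"
    by (simp add: add_ac)
  also have "\<dots> = shifted_harm (real n + b) + 1 / (real (Suc n) + b)"
    using assms by (subst shifted_harm_plus1) (auto simp: add_ac)
  finally show ?case by (simp add: Suc.IH)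
qed auto

lemma shifted_harm_mono:
  fixes b c :: real
  assumes "0 \<le> b" "b \<le> c"
  shows "shifted_harm b \<le> shifted_harm c"
  using assms
  by (intro sums_le[OF _ shifted_harm_sums shifted_harm_sums] diff_left_mono divide_left_mono) auto

lemma shifted_harm_nonneg: "b \<ge> 0 \<Longrightarrow> shifted_harm (b::real) \<ge> 0"
  using shifted_harm_mono[of 0 b] by (simp add: shifted_harm_0)

lemma riemann_zeta_sums:
  assumes "m \<ge> 2"
  shows "(\<lambda>n. 1 / real (Suc n) ^ m) sums riemann_zeta m"
proof -
  have "summable (\<lambda>n. inverse (real (Suc n) ^ m))"
    using inverse_power_summable[OF assms, where ?'a = real] by (subst summable_Suc_iff) simp
  thus ?thesis
    unfolding riemann_zeta_def by (simp add: summable_sums inverse_eq_divide)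
qed

lemma shifted_harm_order_sums:
  fixes b :: real
  assumes "b \<ge> 0" "m \<ge> 2"
  shows "(\<lambda>n. 1 / real (Suc n) ^ m - 1 / (real (Suc n) + b) ^ m) sums shifted_harm_order m b"
proof -
  have "summable (\<lambda>n. 1 / (real (Suc n) + b) ^ m)"
  proof (rule summable_comparison_test')
    show "summable (\<lambda>n. 1 / real (Suc n) ^ m)"
      using riemann_zeta_sums[OF assms(2)] by (rule sums_summable)
    fix n
    have "0 < real (Suc n) + b" using assms(1) by simp
    thus "norm (1 / (real (Suc n) + b) ^ m) \<le> 1 / real (Suc n) ^ m"
      using assms(1) by (auto simp: power_abs intro!: divide_left_mono power_mono)
  qed
  hence "(\<lambda>n. 1 / (real (Suc n) + b) ^ m) sums hurwitz_zeta m (b + 1)"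
    unfolding hurwitz_zeta_def by (simp add: summable_sums add_ac)
  from sums_diff[OF riemann_zeta_sums[OF assms(2)] this] show ?thesis
    by (simp add: shifted_harm_order_def)
qed

lemma shifted_harm_order_0: "m \<ge> 2 \<Longrightarrow> shifted_harm_order m (0::real) = 0"
  using shifted_harm_order_sums[of 0 m] by (simp add: sums_iff)

lemma shifted_harm_order_plus1:
  fixes b :: real
  assumes "b \<ge> 0" "m \<ge> 2"
  shows "shifted_harm_order m (b + 1) = shifted_harm_order m b + 1 / (b + 1) ^ m"
proof -
  let ?f = "\<lambda>n. 1 / (real (Suc n) + b) ^ m"
  have "(\<lambda>n. 1 / real (Suc n) ^ m - (1 / real (Suc n) ^ m - 1 / (real (Suc n) + b) ^ m))
          sums (riemann_zeta m - shifted_harm_order m b)"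
    by (intro sums_diff riemann_zeta_sums shifted_harm_order_sums assms)
  hence "?f sums (riemann_zeta m - shifted_harm_order m b)" by simp
  hence "(\<lambda>n. ?f (Suc n)) sums (riemann_zeta m - shifted_harm_order m b - ?f 0)"
    by (subst sums_Suc_iff) simp
  from sums_diff[OF riemann_zeta_sums[OF assms(2)] this]
  have "(\<lambda>n. 1 / real (Suc n) ^ m - 1 / (real (Suc n) + (b + 1)) ^ m)
      sums (shifted_harm_order m b + 1 / (b + 1) ^ m)"
    by (simp add: add_ac)
  with shifted_harm_order_sums[of "b + 1" m] assms show ?thesis
    by (auto dest: sums_unique2)
qed

lemma shifted_harm_order_mono:
  fixes b c :: real
  assumes "0 \<le> b" "b \<le> c" "m \<ge> 2"
  shows "shifted_harm_order m b \<le> shifted_harm_order m c"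
  using assms
  by (intro sums_le[OF _ shifted_harm_order_sums shifted_harm_order_sums]
        diff_left_mono divide_left_mono power_mono) auto

lemma shifted_harm_order_nonneg:
  "b \<ge> 0 \<Longrightarrow> m \<ge> 2 \<Longrightarrow> shifted_harm_order m (b::real) \<ge> 0"
  using shifted_harm_order_mono[of 0 b m] by (simp add: shifted_harm_order_0)

lemma shifted_harm_order_le_zeta:
  fixes b :: real
  assumes "b \<ge> 0" "m \<ge> 2"
  shows "shifted_harm_order m b \<le> riemann_zeta m"
  by (rule sums_le[OF _ shifted_harm_order_sums[OF assms] riemann_zeta_sums[OF assms(2)]])
    (use assms in auto)

section \<open>Ordinary harmonic numbers of higher order\<close>

lemma harm_order_0 [simp]: "harm_order m 0 = 0"
  by (simp add: harm_order_def)

lemma harm_order_Suc: "harm_order m (Suc n) = harm_order m n + 1 / of_nat (Suc n) ^ m"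
  by (simp add: harm_order_def)

lemma harm_order_nonneg: "0 \<le> (harm_order m n :: real)"
  by (simp add: harm_order_def sum_nonneg)

lemma harm_order_le_harm:
  assumes "m \<ge> 1"
  shows "harm_order m n \<le> (harm n :: real)"
  unfolding harm_order_def harm_def
proof (rule sum_mono)
  fix j assume "j \<in> {1..n}"
  hence "real j ^ 1 \<le> real j ^ m" "real j > 0"
    using assms power_increasing[of 1 m "real j"] by auto
  thus "1 / real j ^ m \<le> inverse (real j)"
    by (simp add: field_simps)
qed

lemma harm_order_le_zeta:
  assumes "m \<ge> 2"
  shows "harm_order m n \<le> (riemann_zeta m :: real)"
proof -
  have "(harm_order m n :: real) = (\<Sum>j<n. 1 / real (Suc j) ^ m)"
    by (induction n) (simp_all add: harm_order_Suc)
  also have "\<dots> \<le> riemann_zeta m"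
    using riemann_zeta_sums[OF assms] by (metis sum_le_suminf sums_iff finite_lessThan
      divide_nonneg_nonneg zero_le_one of_nat_0_le_iff zero_le_power)
  finally show ?thesis .
qed

section \<open>Elementary symmetric functions of the reciprocals\<close>

text \<open>
  \<open>recip_esym m n\<close> is the \<open>m\<close>-th elementary symmetric polynomial in \<open>1, 1/2, \<dots>, 1/n\<close>; the recursion
  sorts its monomials by whether they contain the last variable.
\<close>
fun recip_esym :: "nat \<Rightarrow> nat \<Rightarrow> real" where
  "recip_esym 0 n = 1"
| "recip_esym (Suc m) 0 = 0"
| "recip_esym (Suc m) (Suc n) = recip_esym (Suc m) n + recip_esym m n / real (Suc n)"

lemma recip_esym_nonneg: "0 \<le> recip_esym m n"
  by (induction m n rule: recip_esym.induct) auto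

lemma recip_esym_le_harm_power: "recip_esym m n \<le> harm n ^ m"
proof (induction m n rule: recip_esym.induct)
  case (3 m n)
  have "recip_esym (Suc m) (Suc n) \<le> harm n ^ Suc m + harm n ^ m / real (Suc n)"
    unfolding recip_esym.simps by (intro add_mono divide_right_mono 3) auto
  also have "\<dots> = harm (Suc n) * harm n ^ m"
    by (simp add: harm_Suc inverse_eq_divide algebra_simps)
  also have "\<dots> \<le> harm (Suc n) ^ Suc m"
    by (auto intro!: mult_left_mono power_mono harm_mono harm_nonneg)
  finally show ?case .
qed (auto simp: harm_expand)

text \<open>
  Newton's identities for orders 1, 2 and 3: the power sums of the reciprocals are harmonic numbers.
\<close>
lemma recip_esym_1: "recip_esym 1 n = harm n"
  by (induction n) (auto simp: harm_expand harm_Suc inverse_eq_divide)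

lemma recip_esym_2: "recip_esym 2 n = (harm n ^ 2 - harm_order 2 n) / 2"
proof (induction n)
  case (Suc n)
  define x where "x = 1 / real (Suc n)"
  have "recip_esym 2 (Suc n) = recip_esym 2 n + harm n * x"
    using recip_esym_1[of n] by (simp add: numeral_2_eq_2 x_def)
  moreover have "harm (Suc n) = harm n + x" "harm_order 2 (Suc n) = harm_order 2 n + x ^ 2"
    by (simp_all add: harm_Suc harm_order_Suc x_def inverse_eq_divide power_divide)
  ultimately show ?case unfolding Suc.IH
    by (simp add: field_simps power2_eq_square)
qed (auto simp: harm_expand numeral_2_eq_2)

lemma recip_esym_3:
  "recip_esym 3 n = (harm n ^ 3 - 3 * harm n * harm_order 2 n + 2 * harm_order 3 n) / 6"
proof (induction n)
  case (Suc n)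
  define x where "x = 1 / real (Suc n)"
  have "recip_esym 3 (Suc n) = recip_esym 3 n + recip_esym 2 n * x"
    by (simp add: numeral_2_eq_2 numeral_3_eq_3 x_def)
  moreover have "harm (Suc n) = harm n + x" "harm_order 2 (Suc n) = harm_order 2 n + x ^ 2"
    "harm_order 3 (Suc n) = harm_order 3 n + x ^ 3"
    by (simp_all add: harm_Suc harm_order_Suc x_def inverse_eq_divide power_divide)
  ultimately show ?case unfolding Suc.IH recip_esym_2
    by (simp add: field_simps power2_eq_square power3_eq_cube)
qed (auto simp: harm_expand numeral_3_eq_3)

section \<open>Series of elementary symmetric functions\<close>

text \<open>
  The value at \<open>b\<close> continues the complete homogeneous symmetric polynomial of degree \<open>m + 1\<close> in
  \<open>1, 1/2, \<dots>, 1/b\<close> from natural to real \<open>b\<close>; for \<open>m = 0\<close> it is the defining series of the harmonic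
  number with index \<open>b\<close>.
\<close>
definition esym_series :: "nat \<Rightarrow> real \<Rightarrow> real" where
  "esym_series m b = (\<Sum>n. recip_esym m n * (1 / real (Suc n) - 1 / (real (Suc n) + b)))"

lemma esym_series_sums:
  assumes "b \<ge> 0"
  shows "(\<lambda>n. recip_esym m n * (1 / real (Suc n) - 1 / (real (Suc n) + b))) sums esym_series m b"
  unfolding esym_series_def
proof (rule summable_sums, rule summable_comparison_test')
  show "summable (\<lambda>n. b * (harm (Suc n) ^ m / real (Suc n) ^ 2))"
    by (intro summable_mult summable_harm_power_over_square)
  fix n
  define x where "x = real (Suc n)"
  have x: "x > 0" by (simp add: x_def)
  have "recip_esym m n \<le> harm (Suc n) ^ m"
    using recip_esym_le_harm_power[of m n] power_mono[OF harm_mono[of n "Suc n"] harm_nonneg, of m]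
    by (meson le_SucI order.refl order.trans)
  moreover have eq: "1 / x - 1 / (x + b) = b / (x * (x + b))"
    using x assms by (simp add: field_simps)
  have "b / (x * (x + b)) \<le> b / x ^ 2"
    unfolding power2_eq_square using x assms by (intro divide_left_mono mult_left_mono) auto
  moreover have "0 \<le> b / (x * (x + b))" using x assms by simp
  ultimately have "recip_esym m n * (b / (x * (x + b))) \<le> harm (Suc n) ^ m * (b / x ^ 2)"
    using recip_esym_nonneg[of m n] by (intro mult_mono) auto
  moreover have "0 \<le> recip_esym m n * (b / (x * (x + b)))"
    using recip_esym_nonneg[of m n] x assms by simp
  ultimately show "norm (recip_esym m n * (1 / real (Suc n) - 1 / (real (Suc n) + b)))
      \<le> b * (harm (Suc n) ^ m / real (Suc n) ^ 2)"
    unfolding x_def[symmetric] eq real_norm_def by (simp only: abs_of_nonneg) (simp add: mult_ac)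
qed

lemma esym_series_at_0: "esym_series m 0 = 0"
  using esym_series_sums[of 0 m] by (simp add: sums_iff)

lemma esym_series_mono:
  assumes "0 \<le> b" "b \<le> c"
  shows "esym_series m b \<le> esym_series m c"
  using assms
  by (intro sums_le[OF _ esym_series_sums esym_series_sums] mult_left_mono diff_left_mono
        divide_left_mono recip_esym_nonneg) auto

text \<open>
  Differencing \<open>recip_esym (Suc m)\<close> lowers its order and produces the factor \<open>1 / x\<close>; then
  \<open>1 / (x (x + b)) = (1 / x - 1 / (x + b)) / b\<close> turns the series into \<open>esym_series m b\<close>.
\<close>
lemma recip_esym_consecutive_sums:
  assumes "b > 0"
  shows "(\<lambda>n. recip_esym (Suc m) (Suc n) / ((real (Suc n) + b) * (real (Suc n) + b + 1)))
           sums (esym_series m b / b)"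
proof (rule sums_consecutive_denominators)
  have "(\<lambda>n. recip_esym m n * (1 / real (Suc n) - 1 / (real (Suc n) + b)) / b)
          sums (esym_series m b / b)"
    using assms by (intro sums_divide esym_series_sums) auto
  moreover have "recip_esym m n * (1 / real (Suc n) - 1 / (real (Suc n) + b)) / b
      = (recip_esym (Suc m) (Suc n) - recip_esym (Suc m) n) / (real (Suc n) + b)" for n
  proof -
    define x where "x = real (Suc n)"
    have "x > 0" by (simp add: x_def)
    hence eq: "(1 / x - 1 / (x + b)) / b = 1 / x / (x + b)"
      using assms by (simp add: divide_simps)
    have "c * (1 / x - 1 / (x + b)) / b = c / x / (x + b)" for c
      using arg_cong[OF eq, of "\<lambda>t. c * t"] by simp
    thus ?thesis
      unfolding recip_esym.simps x_def[symmetric] by simp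
  qed
  ultimately show "(\<lambda>n. (recip_esym (Suc m) (Suc n) - recip_esym (Suc m) n) / (real (Suc n) + b))
      sums (esym_series m b / b)" by simp
  show "recip_esym (Suc m) n \<le> harm n ^ Suc m" for n by (rule recip_esym_le_harm_power)
qed (use assms recip_esym_nonneg in auto)

text \<open>
  For natural \<open>b\<close> this is the rule for adding the variable \<open>1 / (b + 1)\<close> to a complete homogeneous
  symmetric polynomial. It holds for real \<open>b\<close> because raising \<open>b\<close> by one replaces the weights by the
  consecutive denominators of the preceding lemma.
\<close>
lemma esym_series_plus1:
  assumes "b \<ge> 0"
  shows "esym_series (Suc m) (b + 1) - esym_series (Suc m) b = esym_series m (b + 1) / (b + 1)"
proof -
  define f where
    "f = (\<lambda>n. recip_esym (Suc m) n / ((real n + (b + 1)) * (real n + (b + 1) + 1)))"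
  have "(\<lambda>n. f (Suc n)) sums (esym_series m (b + 1) / (b + 1))"
    unfolding f_def using assms by (intro recip_esym_consecutive_sums) auto
  hence "f sums (esym_series m (b + 1) / (b + 1))"
    by (subst (asm) sums_Suc_iff) (simp add: f_def)
  moreover have "(\<lambda>n. recip_esym (Suc m) n * (1 / real (Suc n) - 1 / (real (Suc n) + (b + 1)))
       - recip_esym (Suc m) n * (1 / real (Suc n) - 1 / (real (Suc n) + b)))
       sums (esym_series (Suc m) (b + 1) - esym_series (Suc m) b)" (is "?g sums _")
    using assms by (intro sums_diff esym_series_sums) auto
  moreover have "?g = f"
  proof
    fix n
    define y where "y = real (Suc n) + b"
    have "y > 0" "y + 1 > 0" using assms by (auto simp: y_def)
    hence eq: "1 / y - 1 / (y + 1) = 1 / (y * (y + 1))" by (simp add: field_simps)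
    have "?g n = recip_esym (Suc m) n * (1 / y - 1 / (y + 1))"
      by (simp add: y_def algebra_simps)
    also have "\<dots> = f n"
      unfolding eq f_def by (simp add: y_def add_ac)
    finally show "?g n = f n" .
  qed
  ultimately show ?thesis by (auto dest: sums_unique2)
qed

text \<open>
  The difference of two solutions has period 1 and vanishes at the natural numbers. Far out, both
  functions are squeezed, by monotonicity, between their common values at two neighbouring natural
  numbers, and these values approach each other; so the periodic difference is 0 everywhere.
\<close>
lemma mono_solutions_difference_equation_unique:
  fixes f g :: "real \<Rightarrow> real"
  assumes mono: "\<And>x y. 0 \<le> x \<Longrightarrow> x \<le> y \<Longrightarrow> f x \<le> f y" "\<And>x y. 0 \<le> x \<Longrightarrow> x \<le> y \<Longrightarrow> g x \<le> g y"
    and zero: "f 0 = g 0"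
    and step: "\<And>x. 0 \<le> x \<Longrightarrow> f (x + 1) - f x = g (x + 1) - g x"
    and lim: "(\<lambda>n. f (real n + 1) - f (real n)) \<longlonglongrightarrow> 0"
    and "0 \<le> b"
  shows "f b = g b"
proof -
  have shift: "f (b + real n) - g (b + real n) = f b - g b" if "0 \<le> b" for b n
  proof (induction n)
    case (Suc n)
    show ?case using step[of "b + real n"] Suc that by (simp add: add_ac)
  qed auto
  have nat: "f (real n) = g (real n)" for n
    using shift[of 0 n] zero by simp
  define M where "M = nat \<lfloor>b\<rfloor>"
  have M: "real M \<le> b" "b \<le> real M + 1"
    using \<open>0 \<le> b\<close> by (auto simp: M_def)
  have "\<bar>f b - g b\<bar> \<le> f (real (n + M) + 1) - f (real (n + M))" for n
  proof -
    have le: "real (n + M) \<le> b + real n" "b + real n \<le> real (n + M) + 1"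
      using M by auto
    have "g (real (n + M) + 1) = f (real (n + M) + 1)"
      using nat[of "n + M + 1"] by (simp add: add_ac)
    with mono(1)[OF _ le(1)] mono(2)[OF _ le(1)] mono(1)[OF _ le(2)] mono(2)[OF _ le(2)]
      nat[of "n + M"] shift[OF \<open>0 \<le> b\<close>, of n] \<open>0 \<le> b\<close>
    show ?thesis by linarith
  qed
  with LIMSEQ_ignore_initial_segment[OF lim, of M] have "\<bar>f b - g b\<bar> \<le> 0"
    by (intro LIMSEQ_le_const) auto
  thus ?thesis by simp
qed

lemma esym_series_0: "b \<ge> 0 \<Longrightarrow> esym_series 0 b = shifted_harm b"
  using shifted_harm_sums[of b] by (simp add: esym_series_def sums_iff)

text \<open>
  A closed form of order \<open>Suc m\<close> can be verified by its difference equation alone. The increments at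
  the natural numbers are values of the preceding order divided by the argument, hence the
  condition on the limit.
\<close>
lemma esym_series_Suc_eqI:
  assumes prev: "\<And>x. 0 \<le> x \<Longrightarrow> esym_series m x = h x"
    and mono: "\<And>x y. 0 \<le> x \<Longrightarrow> x \<le> y \<Longrightarrow> g x \<le> g y" and zero: "g 0 = 0"
    and step: "\<And>x. 0 \<le> x \<Longrightarrow> g (x + 1) - g x = h (x + 1) / (x + 1)"
    and lim: "(\<lambda>n. h (real (Suc n)) / real (Suc n)) \<longlonglongrightarrow> 0"
    and "0 \<le> b"
  shows "esym_series (Suc m) b = g b"
proof (rule mono_solutions_difference_equation_unique[OF _ mono])
  have step': "esym_series (Suc m) (x + 1) - esym_series (Suc m) x = h (x + 1) / (x + 1)"
    if "0 \<le> x" for x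
    using esym_series_plus1[of x m] prev[of "x + 1"] that by simp
  show "(\<lambda>n. esym_series (Suc m) (real n + 1) - esym_series (Suc m) (real n)) \<longlonglongrightarrow> 0"
    using lim by (subst step') (simp_all add: add_ac)
  show "esym_series (Suc m) (x + 1) - esym_series (Suc m) x = g (x + 1) - g x" if "0 \<le> x" for x
    using step step' that by simp
qed (use esym_series_mono esym_series_at_0 zero \<open>0 \<le> b\<close> in auto)

text \<open>
  Orders 1 and 2 are the complete homogeneous polynomials of degrees 2 and 3 expressed by power
  sums, that is, by the harmonic numbers of index \<open>b\<close>. All signs are positive, so monotonicity is
  immediate.
\<close>
lemma esym_series_1:
  assumes "b \<ge> 0"
  shows "esym_series 1 b = (shifted_harm b ^ 2 + shifted_harm_order 2 b) / 2"
  unfolding One_nat_def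
proof (rule esym_series_Suc_eqI[OF esym_series_0])
  show "(shifted_harm x ^ 2 + shifted_harm_order 2 x) / 2
      \<le> (shifted_harm y ^ 2 + shifted_harm_order 2 y) / 2" if "0 \<le> x" "x \<le> y" for x y :: real
    using that by (intro divide_right_mono add_mono power_mono shifted_harm_mono
        shifted_harm_order_mono shifted_harm_nonneg) auto
  show "(shifted_harm (x + 1) ^ 2 + shifted_harm_order 2 (x + 1)) / 2
      - (shifted_harm x ^ 2 + shifted_harm_order 2 x) / 2 = shifted_harm (x + 1) / (x + 1)"
    if "0 \<le> x" for x :: real
  proof -
    define t where "t = 1 / (x + 1)"
    have "shifted_harm (x + 1) = shifted_harm x + t"
      using that unfolding t_def by (intro shifted_harm_plus1) auto
    moreover have "shifted_harm_order 2 (x + 1) = shifted_harm_order 2 x + t ^ 2"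
      using that by (simp add: shifted_harm_order_plus1 power_divide t_def)
    moreover have "c / (x + 1) = c * t" for c by (simp add: t_def)
    ultimately show ?thesis
      by (simp add: field_simps power2_eq_square)
  qed
  show "(\<lambda>n. shifted_harm (real (Suc n)) / real (Suc n)) \<longlonglongrightarrow> 0"
    using harm_power_over_index_tendsto_0[of 1]
    by (simp add: shifted_harm_of_nat del: of_nat_Suc)
qed (use assms in \<open>auto simp: shifted_harm_0 shifted_harm_order_0\<close>)

lemma esym_series_2:
  assumes "b \<ge> 0"
  shows "esym_series 2 b = (shifted_harm b ^ 3 + 3 * shifted_harm b * shifted_harm_order 2 b
           + 2 * shifted_harm_order 3 b) / 6" (is "_ = ?g b")
proof (subst numeral_2_eq_2, rule esym_series_Suc_eqI[where g = ?g, OF esym_series_1[unfolded One_nat_def]])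
  show "?g x \<le> ?g y" if "0 \<le> x" "x \<le> y" for x y :: real
    using that by (intro divide_right_mono add_mono power_mono mult_mono shifted_harm_mono
        shifted_harm_order_mono shifted_harm_nonneg shifted_harm_order_nonneg
        mult_nonneg_nonneg) auto
  show "?g (x + 1) - ?g x
      = ((shifted_harm (x + 1) ^ 2 + shifted_harm_order 2 (x + 1)) / 2) / (x + 1)"
    if "0 \<le> x" for x :: real
  proof -
    define t where "t = 1 / (x + 1)"
    have "shifted_harm (x + 1) = shifted_harm x + t"
      using that unfolding t_def by (intro shifted_harm_plus1) auto
    moreover have "shifted_harm_order 2 (x + 1) = shifted_harm_order 2 x + t ^ 2"
      "shifted_harm_order 3 (x + 1) = shifted_harm_order 3 x + t ^ 3"
      using that by (simp_all add: shifted_harm_order_plus1 power_divide t_def)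
    moreover have "c / (x + 1) = c * t" for c by (simp add: t_def)
    ultimately show ?thesis
      by (simp add: algebra_simps power2_eq_square power3_eq_cube)
  qed
  have "(\<lambda>n. (harm (Suc n) ^ 2 / real (Suc n)) / 2 + riemann_zeta 2 / 2 * (1 / real (Suc n)))
      \<longlonglongrightarrow> 0 / 2 + riemann_zeta 2 / 2 * 0"
    by (intro tendsto_intros harm_power_over_index_tendsto_0) (simp, real_asymp)
  hence upper: "(\<lambda>n. (harm (Suc n) ^ 2 + riemann_zeta 2) / 2 / real (Suc n)) \<longlonglongrightarrow> 0"
    by (simp add: add_divide_distrib mult_ac del: of_nat_Suc)
  show "(\<lambda>n. (shifted_harm (real (Suc n)) ^ 2 + shifted_harm_order 2 (real (Suc n))) / 2
      / real (Suc n)) \<longlonglongrightarrow> 0"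
    unfolding shifted_harm_of_nat
  proof (rule tendsto_sandwich[OF _ _ tendsto_const upper])
    show "\<forall>\<^sub>F n in sequentially. 0 \<le> (harm (Suc n) ^ 2 + shifted_harm_order 2 (real (Suc n))) / 2
        / real (Suc n)"
      by (intro always_eventually allI divide_nonneg_nonneg add_nonneg_nonneg
          shifted_harm_order_nonneg) auto
    show "\<forall>\<^sub>F n in sequentially.
        (harm (Suc n) ^ 2 + shifted_harm_order 2 (real (Suc n))) / 2 / real (Suc n)
        \<le> (harm (Suc n) ^ 2 + riemann_zeta 2) / 2 / real (Suc n)"
      by (intro always_eventually allI divide_right_mono add_left_mono
          shifted_harm_order_le_zeta) auto
  qed
qed (use assms in \<open>auto simp: shifted_harm_0 shifted_harm_order_0\<close>)

section \<open>The two series with consecutive denominators\<close>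

lemma partial_fraction_step:
  fixes x b :: real
  assumes "x > 0" "b > 0"
  shows "1 / (x ^ Suc m * (x + b)) = (1 / x ^ Suc m - 1 / (x ^ m * (x + b))) / b"
  using assms by (simp add: divide_simps)

lemma recip_shifted_sums:
  fixes b :: real
  assumes "b > 0"
  shows "(\<lambda>n. 1 / (real (Suc n) * (real (Suc n) + b))) sums (shifted_harm b / b)"
    and "(\<lambda>n. 1 / (real (Suc n) ^ 2 * (real (Suc n) + b)))
           sums (riemann_zeta 2 / b - shifted_harm b / b ^ 2)"
    and "(\<lambda>n. 1 / (real (Suc n) ^ 3 * (real (Suc n) + b)))
           sums (riemann_zeta 3 / b - riemann_zeta 2 / b ^ 2 + shifted_harm b / b ^ 3)"
proof -
  have eq: "1 / (real (Suc n) ^ Suc m * (real (Suc n) + b))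
      = (1 / real (Suc n) ^ Suc m - 1 / (real (Suc n) ^ m * (real (Suc n) + b))) / b" for n m
    using assms by (intro partial_fraction_step) auto
  have "(\<lambda>n. (1 / real (Suc n) - 1 / (real (Suc n) + b)) / b) sums (shifted_harm b / b)"
    using assms by (intro sums_divide shifted_harm_sums) auto
  thus 1: "(\<lambda>n. 1 / (real (Suc n) * (real (Suc n) + b))) sums (shifted_harm b / b)"
    using eq[of _ 0] by simp
  have "(\<lambda>n. (1 / real (Suc n) ^ 2 - 1 / (real (Suc n) * (real (Suc n) + b))) / b)
      sums ((riemann_zeta 2 - shifted_harm b / b) / b)"
    by (intro sums_divide sums_diff riemann_zeta_sums 1) auto
  thus 2: "(\<lambda>n. 1 / (real (Suc n) ^ 2 * (real (Suc n) + b)))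
           sums (riemann_zeta 2 / b - shifted_harm b / b ^ 2)"
    unfolding numeral_2_eq_2 eq[of _ "Suc 0"]
    by (simp add: diff_divide_distrib power2_eq_square)
  have "(\<lambda>n. (1 / real (Suc n) ^ 3 - 1 / (real (Suc n) ^ 2 * (real (Suc n) + b))) / b)
      sums ((riemann_zeta 3 - (riemann_zeta 2 / b - shifted_harm b / b ^ 2)) / b)"
    by (intro sums_divide sums_diff riemann_zeta_sums 2) auto
  moreover have "(riemann_zeta 3 - (riemann_zeta 2 / b - shifted_harm b / b ^ 2)) / b
      = riemann_zeta 3 / b - riemann_zeta 2 / b ^ 2 + shifted_harm b / b ^ 3"
    using assms by (simp add: field_simps power2_eq_square power3_eq_cube)
  ultimately show "(\<lambda>n. 1 / (real (Suc n) ^ 3 * (real (Suc n) + b)))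
           sums (riemann_zeta 3 / b - riemann_zeta 2 / b ^ 2 + shifted_harm b / b ^ 3)"
    using eq[of _ 2] by simp
qed

text \<open>
  The difference is the tail of the series that defines \<open>shifted_harm b\<close>.
\<close>
lemma shifted_harm_minus_harm_tendsto_0:
  fixes b :: real
  assumes "b \<ge> 0"
  shows "(\<lambda>n. shifted_harm (real n + b) - harm n) \<longlonglongrightarrow> 0"
proof -
  have "shifted_harm (real n + b) - harm n
      = shifted_harm b - (\<Sum>j<n. 1 / real (Suc j) - 1 / (real (Suc j) + b))" for n
    using assms
    by (simp add: shifted_harm_add_of_nat harm_altdef sum_subtractf inverse_eq_divide)
  moreover have "(\<lambda>n. shifted_harm b - (\<Sum>j<n. 1 / real (Suc j) - 1 / (real (Suc j) + b)))
      \<longlonglongrightarrow> shifted_harm b - shifted_harm b"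
    using shifted_harm_sums[of b] assms by (intro tendsto_intros) (auto simp: sums_def)
  ultimately show ?thesis by simp
qed

lemma summable_shifted_harm_over_square:
  fixes b :: real
  assumes "b \<ge> 0"
  shows "summable (\<lambda>n. shifted_harm (real n + b) / real (Suc n) ^ 2)"
proof (rule summable_comparison_test')
  have "summable (\<lambda>n. harm (Suc n) ^ 1 / real (Suc n) ^ 2
      + shifted_harm b * (1 / real (Suc n) ^ 2))"
    using riemann_zeta_sums[of 2]
    by (intro summable_add summable_mult summable_harm_power_over_square) (auto dest: sums_summable)
  thus "summable (\<lambda>n. (harm (Suc n) + shifted_harm b) / real (Suc n) ^ 2)"
    by (simp add: add_divide_distrib)
  fix n
  have "shifted_harm (real n + b) \<le> shifted_harm b + harm n"
    using assms by (auto simp: shifted_harm_add_of_nat harm_altdef inverse_eq_divide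
        intro!: sum_mono divide_left_mono)
  also have "\<dots> \<le> harm (Suc n) + shifted_harm b"
    using harm_mono[of n "Suc n", where ?'a = real] by simp
  finally show "norm (shifted_harm (real n + b) / real (Suc n) ^ 2)
      \<le> (harm (Suc n) + shifted_harm b) / real (Suc n) ^ 2"
    using assms shifted_harm_nonneg[of "real n + b"] by (simp add: divide_right_mono)
qed

text \<open>
  With \<open>u n = H\<^sub>n H\<^sub>n\<^sup>(\<^sup>2\<^sup>)\<close>, summation by parts splits the series according to
  \<open>u (Suc n) - u n = H\<^sub>n / x\<^sup>2 + H\<^sub>n\<^sub>+\<^sub>1\<^sup>(\<^sup>2\<^sup>) / x\<close> with \<open>x = n + 1\<close>. Partial fractions reduce the first part
  to \<open>\<Sum> H\<^sub>n / x\<^sup>2\<close> and \<open>esym_series 1 b\<close>. In the second part \<open>b / (x (x + b))\<close> is the decrement of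
  \<open>w n = H\<^sub>n\<^sub>+\<^sub>b - H\<^sub>n\<close>, so another summation by parts gives \<open>\<Sum> (H\<^sub>n\<^sub>+\<^sub>b - H\<^sub>n) / x\<^sup>2\<close>. The sum
  \<open>\<Sum> H\<^sub>n / x\<^sup>2\<close>, called \<open>A\<close> below, cancels.
\<close>
lemma harm_harm_order_2_sums:
  fixes b :: real
  assumes "b > 0"
  shows "(\<lambda>n. harm (Suc n) * harm_order 2 (Suc n) / ((real (Suc n) + b) * (real (Suc n) + b + 1)))
           sums ((\<Sum>n. shifted_harm (real (Suc n) + b) / real (Suc n) ^ 2) / b
             - (shifted_harm b ^ 2 + shifted_harm_order 2 b) / (2 * b ^ 2)
             - riemann_zeta 2 / b ^ 2 + shifted_harm b / b ^ 3)"
proof -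
  define h2 where "h2 = (shifted_harm b ^ 2 + shifted_harm_order 2 b) / 2"
  define A where "A = (\<Sum>n. harm n / real (Suc n) ^ 2)"
  define V where "V = (\<Sum>n. shifted_harm (real n + b) / real (Suc n) ^ 2)"
  define w where "w = (\<lambda>n. shifted_harm (real n + b) - harm n)"
  have A: "(\<lambda>n. harm n / real (Suc n) ^ 2) sums A"
    unfolding A_def using summable_shifted_harm_over_square[of 0]
    by (intro summable_sums) (simp add: shifted_harm_of_nat)
  have V: "(\<lambda>n. shifted_harm (real n + b) / real (Suc n) ^ 2) sums V"
    unfolding V_def using assms by (intro summable_sums summable_shifted_harm_over_square) auto
  \<comment> \<open>The splitting produces the index \<open>n + b\<close>, the claim has \<open>n + 1 + b\<close>.\<close>
  have Z: "(\<Sum>n. shifted_harm (real (Suc n) + b) / real (Suc n) ^ 2)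
      = V + (riemann_zeta 2 / b - shifted_harm b / b ^ 2)"
  proof -
    have "shifted_harm (real (Suc n) + b) / real (Suc n) ^ 2 = shifted_harm (real n + b) / real (Suc n) ^ 2
        + 1 / (real (Suc n) ^ 2 * (real (Suc n) + b))" for n
      using shifted_harm_plus1[of "real n + b"] assms
      by (simp add: add_ac add_divide_distrib mult.commute)
    with sums_add[OF V recip_shifted_sums(2)[OF assms]] show ?thesis
      by (simp add: sums_iff)
  qed

  have E: "(\<lambda>n. harm n * (1 / real (Suc n) - 1 / (real (Suc n) + b))) sums h2"
    unfolding h2_def esym_series_1[OF less_imp_le[OF assms], symmetric] recip_esym_1[symmetric]
    using assms by (intro esym_series_sums) auto
  have "(\<lambda>n. (harm n / real (Suc n) ^ 2
      - harm n * (1 / real (Suc n) - 1 / (real (Suc n) + b)) / b) / b) sums ((A - h2 / b) / b)"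
    by (intro sums_divide sums_diff A E)
  moreover have "(harm n / real (Suc n) ^ 2
      - harm n * (1 / real (Suc n) - 1 / (real (Suc n) + b)) / b) / b
      = harm n / (real (Suc n) ^ 2 * (real (Suc n) + b))" for n
  proof -
    define x where "x = real (Suc n)"
    have "x > 0" by (simp add: x_def)
    hence eq: "(1 / x ^ 2 - (1 / x - 1 / (x + b)) / b) / b = 1 / (x ^ 2 * (x + b))"
      using assms by (simp add: divide_simps) (simp add: algebra_simps power2_eq_square)
    have "(c / x ^ 2 - c * (1 / x - 1 / (x + b)) / b) / b = c / (x ^ 2 * (x + b))" for c
      using arg_cong[OF eq, of "\<lambda>t. c * t"] by (simp add: algebra_simps)
    thus ?thesis unfolding x_def by simp
  qed
  ultimately have first: "(\<lambda>n. harm n / (real (Suc n) ^ 2 * (real (Suc n) + b)))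
      sums ((A - h2 / b) / b)" by simp

  have second: "(\<lambda>n. harm_order 2 (Suc n) / (real (Suc n) * (real (Suc n) + b)))
      sums ((V - A) / b)"
  proof -
    have w0: "w \<longlonglongrightarrow> 0"
      unfolding w_def using assms by (intro shifted_harm_minus_harm_tendsto_0) auto
    have "(\<lambda>n. (harm_order 2 (Suc n) - harm_order 2 n) * w n) sums (V - A)"
      using sums_diff[OF V A] by (simp add: harm_order_Suc w_def diff_divide_distrib)
    moreover have "(\<lambda>n. harm_order 2 n * w n) \<longlonglongrightarrow> 0"
    proof (rule Lim_null_comparison)
      show "\<forall>\<^sub>F n in sequentially. norm (harm_order 2 n * w n) \<le> riemann_zeta 2 * \<bar>w n\<bar>"
        using harm_order_nonneg[of 2] harm_order_le_zeta[of 2]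
        by (intro always_eventually allI) (auto simp: abs_mult intro!: mult_right_mono)
      show "(\<lambda>n. riemann_zeta 2 * \<bar>w n\<bar>) \<longlonglongrightarrow> 0"
        using tendsto_mult_right_zero[OF tendsto_rabs_zero[OF w0]] .
    qed
    ultimately have "(\<lambda>n. harm_order 2 (Suc n) * (w n - w (Suc n)) / b) sums ((V - A) / b)"
      by (intro sums_divide sums_summation_by_parts) auto
    moreover have "harm_order 2 (Suc n) * (w n - w (Suc n)) / b
        = harm_order 2 (Suc n) / (real (Suc n) * (real (Suc n) + b))" for n
    proof -
      have "w n - w (Suc n) = 1 / real (Suc n) - 1 / (real (Suc n) + b)"
        using shifted_harm_plus1[of "real n + b"] assms
        by (simp add: w_def harm_Suc inverse_eq_divide add_ac)
      also have "\<dots> = b / (real (Suc n) * (real (Suc n) + b))"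
        using assms by (simp add: divide_simps)
      finally show ?thesis using assms by simp
    qed
    ultimately show ?thesis by simp
  qed

  have "(\<lambda>n. harm (Suc n) * harm_order 2 (Suc n) / ((real (Suc n) + b) * (real (Suc n) + b + 1)))
          sums ((A - h2 / b) / b + (V - A) / b)"
  proof (rule sums_consecutive_denominators)
    show "harm n * harm_order 2 n \<le> (harm n ^ 2 :: real)" for n
      using harm_order_le_harm[of 2 n] harm_nonneg[of n, where ?'a = real]
      by (auto simp: power2_eq_square intro: mult_left_mono)
    have "harm n / (real (Suc n) ^ 2 * (real (Suc n) + b))
        + harm_order 2 (Suc n) / (real (Suc n) * (real (Suc n) + b))
        = (harm (Suc n) * harm_order 2 (Suc n) - harm n * harm_order 2 n) / (real (Suc n) + b)" for n
    proof -
      define x where "x = real (Suc n)"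
      have h: "harm (Suc n) = harm n + 1 / x" "harm_order 2 n = harm_order 2 (Suc n) - 1 / x ^ 2"
        by (simp_all add: harm_Suc harm_order_Suc x_def inverse_eq_divide)
      have "harm (Suc n) * harm_order 2 (Suc n) - harm n * harm_order 2 n
          = harm n / x ^ 2 + harm_order 2 (Suc n) / x"
        unfolding h by (simp add: algebra_simps)
      thus ?thesis
        unfolding x_def[symmetric] by (simp add: add_divide_distrib)
    qed
    with sums_add[OF first second]
    show "(\<lambda>n. (harm (Suc n) * harm_order 2 (Suc n) - harm n * harm_order 2 n) / (real (Suc n) + b))
        sums ((A - h2 / b) / b + (V - A) / b)" by simp
  qed (use assms in \<open>auto simp: harm_expand harm_nonneg harm_order_nonneg\<close>)
  moreover have "(A - h2 / b) / b + (V - A) / b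
      = (V + (riemann_zeta 2 / b - shifted_harm b / b ^ 2)) / b - h2 / b ^ 2
        - riemann_zeta 2 / b ^ 2 + shifted_harm b / b ^ 3"
    using assms by (simp add: field_simps power2_eq_square power3_eq_cube)
  ultimately show ?thesis
    unfolding Z by (simp add: h2_def)
qed

lemma harm_order_3_sums:
  fixes b :: real
  assumes "b > 0"
  shows "(\<lambda>n. harm_order 3 (Suc n) / ((real (Suc n) + b) * (real (Suc n) + b + 1)))
           sums (riemann_zeta 3 / b - riemann_zeta 2 / b ^ 2 + shifted_harm b / b ^ 3)"
proof (rule sums_consecutive_denominators)
  show "harm_order 3 n \<le> (harm n ^ 1 :: real)" for n
    using harm_order_le_harm[of 3 n] by simp
  show "(\<lambda>n. (harm_order 3 (Suc n) - harm_order 3 n) / (real (Suc n) + b))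
      sums (riemann_zeta 3 / b - riemann_zeta 2 / b ^ 2 + shifted_harm b / b ^ 3)"
    using recip_shifted_sums(3)[OF assms] by (simp add: harm_order_Suc)
qed (use assms in \<open>auto simp: harm_order_nonneg\<close>)

text \<open>
  The third Newton identity writes the cube as a combination of \<open>H\<^sub>n H\<^sub>n\<^sup>(\<^sup>2\<^sup>)\<close>, \<open>H\<^sub>n\<^sup>(\<^sup>3\<^sup>)\<close> and the third
  elementary symmetric function. The last one contributes \<open>6 * esym_series 2 b / b\<close>, the
  quotient by \<open>b\<close> of the cubic polynomial in the harmonic numbers of index \<open>b\<close>.
\<close>
lemma harm_cubed_sums:
  fixes b :: real
  assumes "b > 0"
  shows "(\<lambda>n. harm (Suc n) ^ 3 / ((real (Suc n) + b) * (real (Suc n) + b + 1)))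
           sums ((shifted_harm b ^ 3 + 3 * shifted_harm b * shifted_harm_order 2 b
               + 2 * shifted_harm_order 3 b) / b
             + 3 * ((\<Sum>n. shifted_harm (real (Suc n) + b) / real (Suc n) ^ 2) / b)
             - 3 / 2 * ((shifted_harm b ^ 2 + shifted_harm_order 2 b) / b ^ 2)
             - 2 * (riemann_zeta 3 / b) - riemann_zeta 2 / b ^ 2 + shifted_harm b / b ^ 3)"
    (is "?f sums ?S")
proof -
  define d where "d = (\<lambda>n. (real (Suc n) + b) * (real (Suc n) + b + 1))"
  have e3: "(\<lambda>n. recip_esym 3 (Suc n) / d n) sums (esym_series 2 b / b)"
    using recip_esym_consecutive_sums[OF assms, of 2] by (simp add: d_def numeral_3_eq_3 numeral_2_eq_2)
  have "(\<lambda>n. 3 * (harm (Suc n) * harm_order 2 (Suc n) / d n) - 2 * (harm_order 3 (Suc n) / d n)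
      + 6 * (recip_esym 3 (Suc n) / d n)) sums
      (3 * ((\<Sum>n. shifted_harm (real (Suc n) + b) / real (Suc n) ^ 2) / b
             - (shifted_harm b ^ 2 + shifted_harm_order 2 b) / (2 * b ^ 2)
             - riemann_zeta 2 / b ^ 2 + shifted_harm b / b ^ 3)
       - 2 * (riemann_zeta 3 / b - riemann_zeta 2 / b ^ 2 + shifted_harm b / b ^ 3)
       + 6 * (esym_series 2 b / b))" (is "?g sums ?T")
    unfolding d_def
    by (intro sums_add sums_diff sums_mult e3[unfolded d_def] harm_harm_order_2_sums
        harm_order_3_sums assms)
  moreover have "?g = ?f"
  proof
    fix n
    have "harm (Suc n) ^ 3 = 3 * (harm (Suc n) * harm_order 2 (Suc n)) - 2 * harm_order 3 (Suc n)
        + 6 * recip_esym 3 (Suc n)"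
      unfolding recip_esym_3 by (simp add: field_simps)
    thus "?g n = ?f n"
      by (simp add: add_divide_distrib diff_divide_distrib d_def)
  qed
  moreover have "?T = ?S"
    using assms by (simp add: esym_series_2) (simp add: field_simps)
  ultimately show ?thesis by (simp only:)
qed

section \<open>Denominators at distance k\<close>

text \<open>
  Telescoping over the steps from \<open>a\<close> to \<open>a + k\<close> gives
  \<open>k / ((x + a) (x + a + k)) = (\<Sum>i<k. 1 / ((x + a + i) (x + a + i + 1)))\<close>.
\<close>
lemma sums_partial_fractions_arith_progression:
  fixes u :: "nat \<Rightarrow> real" and a :: real
  assumes "a > 0" and "k \<ge> 1"
    and "\<And>i. i < k \<Longrightarrow>
      (\<lambda>n. u n / ((real (Suc n) + (a + real i)) * (real (Suc n) + (a + real i) + 1))) sums S i"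
  shows "(\<lambda>n. u n / ((real (Suc n) + a) * (real (Suc n) + a + real k))) sums
           (1 / real k * (\<Sum>i=0..k-1. S i))"
proof -
  have "(\<lambda>n. 1 / real k *
          (\<Sum>i<k. u n / ((real (Suc n) + (a + real i)) * (real (Suc n) + (a + real i) + 1))))
          sums (1 / real k * (\<Sum>i<k. S i))"
    using assms(3) by (intro sums_mult sums_sum) auto
  moreover have "1 / real k *
      (\<Sum>i<k. u n / ((real (Suc n) + (a + real i)) * (real (Suc n) + (a + real i) + 1)))
      = u n / ((real (Suc n) + a) * (real (Suc n) + a + real k))" for n
  proof -
    define y where "y = real (Suc n) + a"
    have y: "y > 0" using assms(1) by (simp add: y_def)
    have "(\<Sum>i<k. u n / ((real (Suc n) + (a + real i)) * (real (Suc n) + (a + real i) + 1)))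
        = (\<Sum>i<k. u n / (y + real i) - u n / (y + real (Suc i)))"
    proof (rule sum.cong[OF refl])
      fix i
      have "y + real i > 0" using y by simp
      hence "u n / ((y + real i) * (y + real i + 1)) = u n / (y + real i) - u n / (y + real i + 1)"
        by (simp add: divide_simps) (simp add: algebra_simps)
      thus "u n / ((real (Suc n) + (a + real i)) * (real (Suc n) + (a + real i) + 1))
          = u n / (y + real i) - u n / (y + real (Suc i))"
        by (simp add: y_def add_ac)
    qed
    also have "\<dots> = u n / y - u n / (y + real k)"
      by (subst sum_lessThan_telescope') simp
    also have "1 / real k * \<dots> = u n / (y * (y + real k))"
      using y assms(2) by (simp add: divide_simps) (simp add: algebra_simps)
    finally show ?thesis by (simp add: y_def)
  qed
  moreover have "{..<k} = {0..k-1}" using assms(2) by auto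
  ultimately show ?thesis by simp
qed

lemma param_harm_minus_1:
  assumes "k \<ge> 1"
  shows "param_harm s k (a - 1) = (\<Sum>i=0..k-1. 1 / (a + real i) ^ s)"
proof -
  have "param_harm s k (a - 1) = (\<Sum>j=Suc 0..Suc (k-1). 1 / (a + real (j - 1)) ^ s)"
    unfolding param_harm_def using assms
    by (intro sum.cong) (auto simp: of_nat_diff algebra_simps)
  thus ?thesis by (subst (asm) sum.shift_bounds_cl_Suc_ivl) simp
qed

text \<open>
  The part of the cubic identity that is free of series and of symmetric polynomials. The sum of the
  terms \<open>H\<^sub>a\<^sub>+\<^sub>i / (a + i)\<^sup>3\<close> with \<open>i \<ge> 1\<close> appears on the right with coefficient 3 instead of 1; the excess is taken back
  in the split form \<open>H\<^sub>a\<^sub>+\<^sub>i = H\<^sub>a + H\<^sub>i\<^sup>(\<^sup>1\<^sup>)(a)\<close>.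
\<close>
lemma sum_elementary_terms:
  fixes a :: real
  assumes "a > 0"
  shows "(\<Sum>i=0..m. shifted_harm (a + real i) / (a + real i) ^ 3
            - 2 * (riemann_zeta 3 / (a + real i)) - riemann_zeta 2 / (a + real i) ^ 2)
      = 3 * (\<Sum>i=1..m. shifted_harm (a + real i) / (a + real i) ^ 3)
        - riemann_zeta 2 * param_harm 2 m a
        - 2 * (\<Sum>i=1..m. param_harm 1 i a / (real i + a) ^ 3)
        - 2 * riemann_zeta 3 * param_harm 1 m a
        - 2 * shifted_harm a * param_harm 3 m a
        - 2 * (riemann_zeta 3 / a) - riemann_zeta 2 / a ^ 2 + shifted_harm a / a ^ 3"
proof (induction m)
  case 0
  show ?case by (simp add: param_harm_def)
next
  case (Suc m)
  have "param_harm 1 n a = (\<Sum>j<n. 1 / (real (Suc j) + a))" for n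
    by (induction n) (auto simp: param_harm_def)
  hence H: "shifted_harm (a + real n) = shifted_harm a + param_harm 1 n a" for n
    using shifted_harm_add_of_nat[of a n] assms by (simp add: add_ac)
  define y where "y = a + real (Suc m)"
  have P: "param_harm s (Suc m) a = param_harm s m a + 1 / y ^ s" for s
    by (simp add: param_harm_def y_def add_ac)
  have yc: "real (Suc m) + a = y" by (simp add: y_def)
  have S: "sum f {0..Suc m} = sum f {0..m} + f (Suc m)" "sum f {1..Suc m} = sum f {1..m} + f (Suc m)"
    for f :: "nat \<Rightarrow> real" by simp_all
  show ?case
    unfolding S Suc.IH P yc using H[of "Suc m"] unfolding y_def[symmetric] P
    by (simp add: algebra_simps add_divide_distrib)
qed

theorem theorem3p5:
  fixes k :: nat and a :: real
  assumes "k \<ge> 1" and "a > 0"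
  shows
    "((\<lambda>n. harm (Suc n) * harm_order 2 (Suc n) /
           ((real (Suc n) + a) * (real (Suc n) + a + real k))) sums
     (1 / real k *
       ((\<Sum>i=0..k-1. 1 / (a + real i) *
            (\<Sum>n. shifted_harm (real (Suc n) + a + real i) / real (Suc n) ^ 2))
        - (\<Sum>i=0..k-1. (shifted_harm (a + real i) ^ 2 + shifted_harm_order 2 (a + real i)) /
                         (2 * (a + real i) ^ 2))
        - riemann_zeta 2 * param_harm 2 k (a - 1)
        + (\<Sum>i=0..k-1. shifted_harm (a + real i) / (a + real i) ^ 3))))
     \<and>
     ((\<lambda>n. harm (Suc n) ^ 3 /
           ((real (Suc n) + a) * (real (Suc n) + a + real k))) sums
     (1 / real k *
       ((\<Sum>i=1..k. (shifted_harm (a + real i - 1) ^ 3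
                    + 3 * shifted_harm (a + real i - 1) * shifted_harm_order 2 (a + real i - 1)
                    + 2 * shifted_harm_order 3 (a + real i - 1)) / (a + real i - 1))
        + 3 * (\<Sum>i=0..k-1. 1 / (a + real i) *
            (\<Sum>n. shifted_harm (real (Suc n) + a + real i) / real (Suc n) ^ 2))
        + 3 * (\<Sum>i=1..k-1. shifted_harm (a + real i) / (a + real i) ^ 3)
        - 3 / 2 * (\<Sum>i=0..k-1. (shifted_harm (a + real i) ^ 2
                                 + shifted_harm_order 2 (a + real i)) / (a + real i) ^ 2)
        - riemann_zeta 2 * param_harm 2 (k - 1) a
        - 2 * (\<Sum>i=1..k-1. param_harm 1 i a / (real i + a) ^ 3)
        - 2 * riemann_zeta 3 * param_harm 1 (k - 1) a
        - 2 * shifted_harm a * param_harm 3 (k - 1) a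
        - 2 * (riemann_zeta 3 / a) - riemann_zeta 2 / a ^ 2 + shifted_harm a / a ^ 3)))"
  (is "(?f sums (1 / real k * ?F)) \<and> (?g sums (1 / real k * ?G))")
proof
  have pos: "a + real i > 0" for i using assms(2) by simp
  note sums = sums_partial_fractions_arith_progression[OF assms(2,1)]
  define Z where "Z = (\<lambda>i. \<Sum>n. shifted_harm (real (Suc n) + a + real i) / real (Suc n) ^ 2)"
  have Z: "(\<Sum>n. shifted_harm (real (Suc n) + (a + real i)) / real (Suc n) ^ 2) = Z i" for i
    by (simp add: Z_def add_ac)
  have Z': "(\<Sum>n. shifted_harm (real (Suc n) + a + real i) / real (Suc n) ^ 2) = Z i" for i
    by (simp only: Z_def)

  have "?F = (\<Sum>i=0..k-1. Z i / (a + real i)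
        - (shifted_harm (a + real i) ^ 2 + shifted_harm_order 2 (a + real i)) / (2 * (a + real i) ^ 2)
        - riemann_zeta 2 / (a + real i) ^ 2 + shifted_harm (a + real i) / (a + real i) ^ 3)"
    unfolding Z' param_harm_minus_1[OF assms(1)]
    by (simp add: sum.distrib sum_subtractf sum_distrib_left)
  with sums[OF harm_harm_order_2_sums[OF pos]] show "?f sums (1 / real k * ?F)"
    unfolding Z by simp

  define h2 where "h2 = (\<lambda>i. (shifted_harm (a + real i) ^ 2 + shifted_harm_order 2 (a + real i))
      / (a + real i) ^ 2)"
  define h3 where "h3 = (\<lambda>i. (shifted_harm (a + real i) ^ 3
      + 3 * shifted_harm (a + real i) * shifted_harm_order 2 (a + real i)
      + 2 * shifted_harm_order 3 (a + real i)) / (a + real i))"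
  have h2: "(shifted_harm (a + real i) ^ 2 + shifted_harm_order 2 (a + real i))
      / (a + real i) ^ 2 = h2 i" for i
    by (simp only: h2_def)
  have h3: "(\<Sum>i=1..k. (shifted_harm (a + real i - 1) ^ 3
                    + 3 * shifted_harm (a + real i - 1) * shifted_harm_order 2 (a + real i - 1)
                    + 2 * shifted_harm_order 3 (a + real i - 1)) / (a + real i - 1))
      = (\<Sum>i=0..k-1. h3 i)" (is "?L = _")
  proof -
    have "?L = (\<Sum>i=Suc 0..Suc (k-1). h3 (i - 1))"
    proof (rule sum.cong)
      fix i assume "i \<in> {Suc 0..Suc (k - 1)}"
      hence "a + real i - 1 = a + real (i - 1)" by (simp add: of_nat_diff)
      thus "(shifted_harm (a + real i - 1) ^ 3
                    + 3 * shifted_harm (a + real i - 1) * shifted_harm_order 2 (a + real i - 1)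
                    + 2 * shifted_harm_order 3 (a + real i - 1)) / (a + real i - 1) = h3 (i - 1)"
        unfolding h3_def by (simp only:)
    qed (use assms(1) in auto)
    thus ?thesis by (subst (asm) sum.shift_bounds_cl_Suc_ivl) simp
  qed
  have "?G = (\<Sum>i=0..k-1. h3 i) + 3 * (\<Sum>i=0..k-1. Z i / (a + real i)) - 3 / 2 * (\<Sum>i=0..k-1. h2 i)
      + (\<Sum>i=0..k-1. shifted_harm (a + real i) / (a + real i) ^ 3
            - 2 * (riemann_zeta 3 / (a + real i)) - riemann_zeta 2 / (a + real i) ^ 2)"
    unfolding h3 sum_elementary_terms[OF assms(2)] Z' h2 by simp
  also have "\<dots> = (\<Sum>i=0..k-1. h3 i + 3 * (Z i / (a + real i)) - 3 / 2 * h2 i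
      - 2 * (riemann_zeta 3 / (a + real i)) - riemann_zeta 2 / (a + real i) ^ 2
      + shifted_harm (a + real i) / (a + real i) ^ 3)"
    by (simp only: sum.distrib sum_subtractf sum_distrib_left)
  finally show "?g sums (1 / real k * ?G)"
    using sums[OF harm_cubed_sums[OF pos]] unfolding Z h2_def h3_def by simp
qed

end
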